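(* For all $m,n\in\mathbb{N}$, there exists an aperiodic subshift of finite type $X$ (over some finite alphabet) such that for every configuration $c\in X$ we have $|\mathcal{L}_{m,n}(c)| = mn+1$.
   Context: Let $A$ be a finite alphabet. A pattern of support $D\subseteq\mathbb{Z}^2$ is an element $p\in A^D$; a configuration is an element $c\in A^{\mathbb{Z}^2}$. A pattern $p$ of support $D$ appears in a pattern or configuration $p'$ if there is $\vec u\in\mathbb{Z}^2$ such that $p_{\vec v}=p'_{\vec v-\vec u}$ for all $\vec v\in D$. For a set $F$ of patterns, $X_F$ is the set of configurations in which no pattern of $F$ appears; a set of this form is a subshift, and it is a subshift of finite type (SFT) if $F$ can be taken finite. For $\vec u\in\mathbb{Z}^2$, the shift $\tau_{\vec u}$ acts by $\tau_{\vec u}(c)_{\vec v}=c_{\vec v-\vec u}$. A configuration $c$ is periodic if $\tau_{\vec u}(c)=c$ for some $\vec u\neq(0,0)$. A subshift is aperiodic if it is nonempty and contains no periodic configuration. For a configuration $c$, $\mathcal{L}_{m,n}(c)$ denotes the set of patterns with support $\{0,\dots,m-1\}\times\{0,\dots,n-1\}$ that appear in $c$. *)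

theory Defs
  imports Main "HOL-Library.Product_Plus"
begin

type_synonym 'a pattern = "int \<times> int \<rightharpoonup> 'a"
type_synonym 'a config = "int \<times> int \<Rightarrow> 'a"

text \<open>
  A pattern is a partial map whose domain is its support. Since an alphabet is a finite set of
  letters and not a type, membership of the letters in the alphabet is stated explicitly.
\<close>

definition patterns :: "'a set \<Rightarrow> 'a pattern set" where
  "patterns A = {p. ran p \<subseteq> A}"

definition configs :: "'a set \<Rightarrow> 'a config set" where
  "configs A = {c. range c \<subseteq> A}"

text \<open>
  For \<open>v \<in> dom p\<close> the equation below forces \<open>v - u \<in> dom q\<close>. A configuration \<open>c\<close> is the
  pattern \<open>Some \<circ> c\<close> of full support.
\<close>

definition appears_in :: "'a pattern \<Rightarrow> 'a pattern \<Rightarrow> bool" where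
  "appears_in p q \<longleftrightarrow> (\<exists>u. \<forall>v\<in>dom p. p v = q (v - u))"

definition avoiding :: "'a set \<Rightarrow> 'a pattern set \<Rightarrow> 'a config set" where
  "avoiding A F = {c \<in> configs A. \<forall>p\<in>F. \<not> appears_in p (Some \<circ> c)}"

text \<open>
  Finitely many forbidden patterns, each of finite support: with infinite supports allowed,
  even a finite \<open>F\<close> could define a set that is not closed.
\<close>

definition subshift_of_finite_type :: "'a set \<Rightarrow> 'a config set \<Rightarrow> bool" where
  "subshift_of_finite_type A X \<longleftrightarrow>
     (\<exists>F \<subseteq> patterns A. finite F \<and> (\<forall>p\<in>F. finite (dom p)) \<and> X = avoiding A F)"

definition shift :: "int \<times> int \<Rightarrow> 'a config \<Rightarrow> 'a config" where
  "shift u c = (\<lambda>v. c (v - u))"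

definition periodic :: "'a config \<Rightarrow> bool" where
  "periodic c \<longleftrightarrow> (\<exists>u. u \<noteq> (0, 0) \<and> shift u c = c)"

definition aperiodic :: "'a config set \<Rightarrow> bool" where
  "aperiodic X \<longleftrightarrow> X \<noteq> {} \<and> (\<forall>c\<in>X. \<not> periodic c)"

definition rect_language :: "nat \<Rightarrow> nat \<Rightarrow> 'a config \<Rightarrow> 'a pattern set" where
  "rect_language m n c =
     {p. dom p = {0..<int m} \<times> {0..<int n} \<and> appears_in p (Some \<circ> c)}"

end

theory Submission imports Defs Complex_Main begin

text \<open>Following Kari, consider arrays of digits in \<open>{2..6}\<close> in which every row represents, up to
  bounded carries, \<open>2\<close> or \<open>2 / 3\<close> times the number represented by the row before it; this is a local
  rule on finitely many tiles. A period \<open>(u, h)\<close> with \<open>h > 0\<close> would make the sums of long segments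
  of rows \<open>0\<close> and \<open>h\<close> differ boundedly, although their ratio is close to \<open>2 ^ h / 3 ^ j \<noteq> 1\<close>. With
  period \<open>(k, 0)\<close> the sums over one period satisfy \<open>2 s\<^sub>y = p s\<^sub>y\<^sub>+\<^sub>1\<close> with \<open>p\<close> odd, so
  \<open>2 ^ h\<close> divides the \<open>h\<close>-th one, which is positive and bounded.

  The tilings are then encoded by binary configurations with ones so sparse that a window of size
  \<open>m \<times> n\<close> sees at most one: its possible contents are the \<open>m n\<close> positions of that one, and zero.
  The encodings form a subshift of finite type because windows of bounded size
  determine the phase of the underlying grid.\<close>

section \<open>An aperiodic set of tiles\<close>

lemma power2_ne_power3: "(2::int) ^ h \<noteq> 3 ^ j" if "h > 0"
proof -
  have "even ((2::int) ^ h)" "odd ((3::int) ^ j)" using that by auto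
  then show ?thesis by metis
qed

text \<open>Passing from row \<open>y\<close> to row \<open>y + 1\<close> multiplies by
  \<open>2 / p y\<close>. The carry \<open>l x y\<close> enters cell \<open>(x, y)\<close> from the
  left, and \<open>l (x + 1) y\<close> leaves it.\<close>

locale multiplier_array =
  fixes p :: "int \<Rightarrow> int" and a l :: "int \<Rightarrow> int \<Rightarrow> int"
  assumes p: "p y = 1 \<or> p y = 3"
    and a: "2 \<le> a x y" "a x y \<le> 6"
    and l: "\<bar>l x y\<bar> \<le> 3"
    and balance: "2 * a x y + l x y = p y * a x (y + 1) + l (x + 1) y"
begin

definition row_sum :: "int \<Rightarrow> int \<Rightarrow> nat \<Rightarrow> int" where
  "row_sum s y k = (\<Sum>i<k. a (s + int i) y)"

text \<open>The carries telescope, so only those at the two ends of the segment survive.\<close>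

lemma row_sum_step:
  "2 * row_sum s y k + l s y = p y * row_sum s (y + 1) k + l (s + int k) y"
proof (induction k)
  case 0
  then show ?case by (simp add: row_sum_def)
next
  case (Suc k)
  then show ?case using balance[of "s + int k" y]
    by (simp add: row_sum_def algebra_simps)
qed

lemma row_sum_bounds: "2 * int k \<le> row_sum s y k" "row_sum s y k \<le> 6 * int k"
proof -
  show "2 * int k \<le> row_sum s y k"
    unfolding row_sum_def using sum_bounded_below[of "{..<k}" 2 "\<lambda>i. a (s + int i) y"] a by simp
  show "row_sum s y k \<le> 6 * int k"
    unfolding row_sum_def using sum_bounded_above[of "{..<k}" "\<lambda>i. a (s + int i) y" 6] a by simp
qed

text \<open>\<open>j\<close> counts the rows with factor 3. Each step doubles the old error and adds
  two end carries scaled by \<open>3 ^ j\<close>, so the bound depends neither on the start nor on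
  the length of the segment.\<close>

lemma row_sum_iterate:
  "\<exists>j C. \<forall>s k. \<bar>2 ^ h * row_sum s y k - 3 ^ j * row_sum s (y + int h) k\<bar> \<le> C"
proof (induction h)
  case 0
  have "\<forall>s k. \<bar>2 ^ 0 * row_sum s y k - 3 ^ 0 * row_sum s (y + int 0) k\<bar> \<le> 0" by simp
  then show ?case by blast
next
  case (Suc h)
  then obtain j C where
    C: "\<bar>2 ^ h * row_sum s y k - 3 ^ j * row_sum s (y + int h) k\<bar> \<le> C" for s k by blast
  define e where "e = (if p (y + int h) = 1 then 0 else 1 :: nat)"
  have pe: "p (y + int h) = 3 ^ e" using p[of "y + int h"] by (auto simp: e_def)
  have "\<bar>2 ^ Suc h * row_sum s y k - 3 ^ (j + e) * row_sum s (y + int (Suc h)) k\<bar>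
      \<le> 2 * C + 3 ^ j * 6" for s k
  proof -
    define u where "u = 2 ^ h * row_sum s y k - 3 ^ j * row_sum s (y + int h) k"
    define v where "v = 2 * row_sum s (y + int h) k - p (y + int h) * row_sum s (y + int h + 1) k"
    have "\<bar>v\<bar> \<le> 6" unfolding v_def
      using row_sum_step[of s "y + int h" k] l[of s "y + int h"] l[of "s + int k" "y + int h"]
      by linarith
    then have "\<bar>3 ^ j * v\<bar> \<le> 3 ^ j * 6" by (simp add: abs_mult)
    moreover have "2 ^ Suc h * row_sum s y k - 3 ^ (j + e) * row_sum s (y + int (Suc h)) k
        = 2 * u + 3 ^ j * v"
      by (simp add: u_def v_def pe power_add algebra_simps)
    moreover have "\<bar>u\<bar> \<le> C" unfolding u_def by (rule C)
    ultimately show ?thesis by linarith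
  qed
  then show ?case by blast
qed

text \<open>Moving by one place exchanges one digit for another. This changes the sum by at most 4,
  for which 6 is generous.\<close>

lemma row_sum_translate:
  "\<bar>row_sum (s + int d) y k - row_sum s y k\<bar> \<le> 6 * int d"
proof (induction d)
  case (Suc d)
  have "row_sum (t + 1) y k = row_sum t y k + a (t + int k) y - a t y" for t
    by (induction k) (simp_all add: row_sum_def algebra_simps)
  from this[of "s + int d"] Suc show ?case
    using a[of "s + int d + int k" y] a[of "s + int d" y] by (simp add: algebra_simps)
qed simp

lemma no_skew_period:
  assumes "u2 > 0" and per: "\<And>x y. a (x + u1) (y + u2) = a x y"
  shows False
proof -
  define h where "h = nat u2"
  have h: "h > 0" "u2 = int h" using assms by (auto simp: h_def)
  obtain j C where
    C: "\<bar>2 ^ h * row_sum s 0 k - 3 ^ j * row_sum s (0 + int h) k\<bar> \<le> C" for s k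
    using row_sum_iterate by blast
  \<comment> \<open>\<open>C\<close> bounds the error of the iteration, the other term the cost of
    moving the segment in row 0 by \<open>u1\<close>. Neither grows with \<open>k\<close>, whereas
    the row sum is at least \<open>2 * k\<close>.\<close>
  define B where "B = C + 2 ^ h * (6 * \<bar>u1\<bar>)"
  have bound: "\<bar>(2 ^ h - 3 ^ j) * row_sum 0 0 k\<bar> \<le> B" for k
  proof -
    have shifted: "row_sum u1 (int h) k = row_sum 0 0 k"
      unfolding row_sum_def
    proof (rule sum.cong)
      fix i show "a (u1 + int i) (int h) = a (0 + int i) 0"
        using per[of "int i" 0] h by (simp add: add.commute)
    qed simp
    have "\<bar>row_sum u1 0 k - row_sum 0 0 k\<bar> \<le> 6 * \<bar>u1\<bar>"
      \<comment> \<open>\<open>row_sum_translate\<close> moves only to the right, so for negative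
        \<open>u1\<close> the segment starts at \<open>u1\<close>.\<close>
      using row_sum_translate[of 0 "nat u1" 0 k] row_sum_translate[of u1 "nat (- u1)" 0 k]
      by (cases "u1 \<ge> 0") auto
    then have "2 ^ h * \<bar>row_sum u1 0 k - row_sum 0 0 k\<bar> \<le> 2 ^ h * (6 * \<bar>u1\<bar>)"
      by (intro mult_left_mono) auto
    then have "\<bar>2 ^ h * (row_sum u1 0 k - row_sum 0 0 k)\<bar> \<le> 2 ^ h * (6 * \<bar>u1\<bar>)"
      by (simp only: abs_mult) simp
    moreover have "(2 ^ h - 3 ^ j) * row_sum 0 0 k
        = (2 ^ h * row_sum u1 0 k - 3 ^ j * row_sum u1 (int h) k)
          - 2 ^ h * (row_sum u1 0 k - row_sum 0 0 k)"
      by (simp add: shifted algebra_simps)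
    ultimately show ?thesis using C[of u1 k] by (simp add: B_def)
  qed
  have "1 \<le> \<bar>(2::int) ^ h - 3 ^ j\<bar>" using power2_ne_power3[OF h(1), of j] by linarith
  then have "1 * row_sum 0 0 k \<le> \<bar>(2::int) ^ h - 3 ^ j\<bar> * row_sum 0 0 k" for k
    using row_sum_bounds(1)[where s=0 and y=0 and k=k] by (intro mult_right_mono) auto
  also have "\<bar>(2::int) ^ h - 3 ^ j\<bar> * row_sum 0 0 k = \<bar>(2 ^ h - 3 ^ j) * row_sum 0 0 k\<bar>" for k
    using row_sum_bounds(1)[where s=0 and y=0 and k=k] by (simp add: abs_mult)
  finally have "row_sum 0 0 k \<le> \<bar>(2 ^ h - 3 ^ j) * row_sum 0 0 k\<bar>" for k by simp
  from order_trans[OF this bound] have "row_sum 0 0 k \<le> B" for k .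
  from this[of "nat (B + 1)"] row_sum_bounds(1)[of "nat (B + 1)" 0 0]
  show False by linarith
qed

lemma no_horizontal_period:
  assumes "u > 0" and per: "\<And>x y. l (x + u) y = l x y"
  shows False
proof -
  define k where "k = nat u"
  have k: "u = int k" "k > 0" using assms by (auto simp: k_def)
  \<comment> \<open>Over a full period the two end carries coincide and cancel.\<close>
  have step: "2 * row_sum 0 y k = p y * row_sum 0 (y + 1) k" for y
    using row_sum_step[of 0 y k] per[of 0 y] k by simp
  have "(2::int) ^ h dvd row_sum 0 (int h) k" for h
  proof (induction h)
    case (Suc h)
    then have "2 * 2 ^ h dvd p (int h) * row_sum 0 (int h + 1) k"
      by (metis step dvd_refl mult_dvd_mono)
    moreover have "coprime (2 ^ Suc h) (p (int h))"
      using p[of "int h"] by auto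
    ultimately show ?case
      by (simp add: coprime_dvd_mult_right_iff add.commute)
  qed simp
  \<comment> \<open>At height \<open>6 * k\<close> the power of 2 overtakes the upper bound
    \<open>6 * k\<close> of every row sum of length \<open>k\<close>.\<close>
  from this[of "6 * k"] have "(2::int) ^ (6 * k) \<le> row_sum 0 (int (6 * k)) k"
    using row_sum_bounds(1)[of k 0 "int (6 * k)"] k by (intro zdvd_imp_le) auto
  also have "\<dots> \<le> int (6 * k)" using row_sum_bounds(2)[of 0 "int (6 * k)" k] by simp
  also have "\<dots> < 2 ^ (6 * k)" by (rule of_nat_less_two_power)
  finally show False by simp
qed

lemma no_period:
  assumes "(u1, u2) \<noteq> (0, 0)"
    and a_per: "\<And>x y. a (x + u1) (y + u2) = a x y"
    and l_per: "\<And>x y. l (x + u1) (y + u2) = l x y"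
  shows False
proof -
  have neg: "a (x + (- u1)) (y + (- u2)) = a x y" "l (x + (- u1)) (y + (- u2)) = l x y" for x y
    using a_per[of "x - u1" "y - u2"] l_per[of "x - u1" "y - u2"] by auto
  consider "u2 > 0" | "u2 < 0" | "u2 = 0" "u1 > 0" | "u2 = 0" "u1 < 0"
    using assms(1) by fastforce
  then show False
  proof cases
    case 1
    then show ?thesis using no_skew_period a_per by blast
  next
    case 2
    then show ?thesis using no_skew_period[of "- u2" "- u1"] neg by force
  next
    case 3
    then show ?thesis using no_horizontal_period[of u1] l_per by simp
  next
    case 4
    then show ?thesis using no_horizontal_period[of "- u1"] neg by simp
  qed
qed

end

lemma bi_infinite_orbit:
  assumes "x0 \<in> S" and f: "\<And>x. x \<in> S \<Longrightarrow> f x \<in> S"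
    and g: "\<And>x. x \<in> S \<Longrightarrow> g x \<in> S" "\<And>x. x \<in> S \<Longrightarrow> f (g x) = x"
  shows "\<exists>r :: int \<Rightarrow> 'a. \<forall>y. r y \<in> S \<and> r (y + 1) = f (r y)"
proof -
  \<comment> \<open>\<open>f\<close> may fail to be injective; the past of the orbit is the chain of
    preimages selected by \<open>g\<close>.\<close>
  define r where "r y = (if y \<ge> 0 then (f ^^ nat y) x0 else (g ^^ nat (- y)) x0)" for y :: int
  have "(f ^^ k) x0 \<in> S" "(g ^^ k) x0 \<in> S" for k
    by (induction k) (auto simp: assms)
  then have r: "r y \<in> S" for y by (simp add: r_def)
  have "r (y + 1) = f (r y)" for y
  proof (cases "y \<ge> 0")
    case True
    then have "nat (y + 1) = Suc (nat y)" by simp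
    with True show ?thesis by (simp add: r_def)
  next
    case False
    then have "nat (- y) = Suc (nat (- (y + 1)))" by simp
    with False have "r y = g (r (y + 1))" by (auto simp: r_def)
    then show ?thesis using g r by simp
  qed
  with r show ?thesis by blast
qed

text \<open>Row \<open>y\<close> holds the digits \<open>\<lfloor>(x + 1) \<alpha>\<rfloor> - \<lfloor>x \<alpha>\<rfloor>\<close> of a number \<open>\<alpha>\<close> in \<open>(2, 6]\<close>, and the next row
  those of \<open>2 \<alpha>\<close> if \<open>\<alpha> \<le> 3\<close> and of \<open>2 \<alpha> / 3\<close> otherwise.\<close>

lemma multiplier_array_exists: "\<exists>p a l. multiplier_array p a l"
proof -
  define f :: "real \<Rightarrow> real" where "f x = (if x \<le> 3 then 2 * x else 2 * x / 3)" for x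
  \<comment> \<open>The threshold 4 matches the branches of \<open>f\<close>: above it
    \<open>x / 2\<close> lies in (2, 3], otherwise \<open>3 * x / 2\<close> lies in (3, 6].\<close>
  define g :: "real \<Rightarrow> real" where "g x = (if x > 4 then x / 2 else 3 * x / 2)" for x
  obtain r :: "int \<Rightarrow> real" where r: "r y \<in> {2<..6}" "r (y + 1) = f (r y)" for y
  proof -
    have "\<exists>r :: int \<Rightarrow> real. \<forall>y. r y \<in> {2<..6} \<and> r (y + 1) = f (r y)"
      by (rule bi_infinite_orbit[of 5 _ f g]) (auto simp: f_def g_def)
    then show ?thesis using that by blast
  qed
  define p where "p y = (if r y \<le> 3 then 1 else 3 :: int)" for y
  define F where "F x y = \<lfloor>of_int x * r y\<rfloor>" for x y
  define a where "a x y = F (x + 1) y - F x y" for x y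
  \<comment> \<open>Carries compare accumulated floors, which turns \<open>balance\<close> into an
    identity.\<close>
  define l where "l x y = 2 * F x y - p y * F x (y + 1)" for x y
  have "multiplier_array p a l"
  proof
    fix x y
    show "p y = 1 \<or> p y = 3" by (simp add: p_def)
    have "of_int x * r y + 2 \<le> of_int (x + 1) * r y" "of_int (x + 1) * r y \<le> of_int x * r y + 6"
      using r(1)[of y] by (auto simp: algebra_simps)
    from this[THEN floor_mono] show "2 \<le> a x y" "a x y \<le> 6"
      by (auto simp: a_def F_def)
    show "2 * a x y + l x y = p y * a x (y + 1) + l (x + 1) y"
      by (simp add: a_def l_def algebra_simps)
    \<comment> \<open>The real parts cancel here, so the carry is a combination of fractional parts,
      strictly between -2 and 3.\<close>
    have "real_of_int (p y) * (of_int x * r (y + 1)) = 2 * (of_int x * r y)"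
      by (simp add: r(2) p_def f_def)
    then have "real_of_int (l x y) = real_of_int (p y) * frac (of_int x * r (y + 1))
        - 2 * frac (of_int x * r y)"
      by (auto simp: l_def F_def frac_def algebra_simps)
    then have "\<bar>real_of_int (l x y)\<bar> \<le> 3"
      using frac_ge_0[of "of_int x * r (y + 1)"] frac_ge_0[of "of_int x * r y"]
        frac_lt_1[of "of_int x * r (y + 1)"] frac_lt_1[of "of_int x * r y"]
      by (cases "r y \<le> 3"; simp add: p_def; linarith)
    then show "\<bar>l x y\<bar> \<le> 3" by linarith
  qed
  then show ?thesis by blast
qed

section \<open>Digit arrays as tilings with a local rule\<close>

definition tilings :: "'t set \<Rightarrow> ('t \<Rightarrow> 't \<Rightarrow> 't \<Rightarrow> bool) \<Rightarrow> (int \<Rightarrow> int \<Rightarrow> 't) set" where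
  "tilings S R = {w. \<forall>x y. w x y \<in> S \<and> R (w x y) (w (x + 1) y) (w x (y + 1))}"

definition multiplier_tiles :: "(int \<times> int \<times> int) set" where
  "multiplier_tiles = {1, 3} \<times> {2..6} \<times> {-3..3}"

text \<open>\<open>p' = p\<close> makes the multiplier a function of the row; the outgoing carry is
  read off the right neighbour.\<close>

fun multiplier_rule :: "int \<times> int \<times> int \<Rightarrow> int \<times> int \<times> int \<Rightarrow> int \<times> int \<times> int \<Rightarrow> bool" where
  "multiplier_rule (p, a, l) (p', a', l') (p'', a'', l'') \<longleftrightarrow> p' = p \<and> 2 * a + l = p * a'' + l'"

lemma multiplier_tilings_nonempty: "tilings multiplier_tiles multiplier_rule \<noteq> {}"
proof -
  obtain p a l where "multiplier_array p a l" using multiplier_array_exists by blast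
  then interpret multiplier_array p a l .
  have "(p y, a x y, l x y) \<in> multiplier_tiles" for x y
    using p[of y] a[of x y] l[of x y] by (auto simp: multiplier_tiles_def)
  then have "(\<lambda>x y. (p y, a x y, l x y)) \<in> tilings multiplier_tiles multiplier_rule"
    by (simp add: tilings_def balance)
  then show ?thesis by blast
qed

lemma multiplier_tiling_no_period:
  assumes w: "w \<in> tilings multiplier_tiles multiplier_rule"
    and u: "(u1, u2) \<noteq> (0, 0)" and per: "\<And>x y. w (x + u1) (y + u2) = w x y"
  shows False
proof -
  define P where "P x y = fst (w x y)" for x y
  define a where "a x y = fst (snd (w x y))" for x y
  define l where "l x y = snd (snd (w x y))" for x y
  have w_eq: "w x y = (P x y, a x y, l x y)" for x y by (simp add: P_def a_def l_def)
  have tile: "(P x y, a x y, l x y) \<in> multiplier_tiles"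
    and rule: "P (x + 1) y = P x y" "2 * a x y + l x y = P x y * a x (y + 1) + l (x + 1) y" for x y
    using w by (auto simp: tilings_def w_eq)
  have P0: "P x y = P 0 y" for x y
  proof (induction x rule: int_induct[where k = 0])
    case (step2 i)
    then show ?case using rule(1)[of "i - 1" y] by simp
  qed (simp_all add: rule(1))
  interpret multiplier_array "P 0" a l
  proof
    fix x y
    show "P 0 y = 1 \<or> P 0 y = 3" "2 \<le> a x y" "a x y \<le> 6" "\<bar>l x y\<bar> \<le> 3"
      using tile[of x y] tile[of 0 y] by (auto simp: multiplier_tiles_def)
    show "2 * a x y + l x y = P 0 y * a x (y + 1) + l (x + 1) y" using rule(2) P0 by metis
  qed
  show False using no_period[OF u] per by (simp add: a_def l_def)
qed

section \<open>Subshifts given by a local condition\<close>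

text \<open>By \<open>loc\<close>, \<open>P\<close> depends only on the values on \<open>W\<close>.
  It therefore suffices to forbid the patterns on \<open>W\<close> that extend to a configuration
  violating \<open>P\<close>, and a finite alphabet admits finitely many of them.\<close>

lemma subshift_of_finite_type_local:
  assumes "finite A" "finite W"
    and loc: "\<And>c c'. (\<And>v. v \<in> W \<Longrightarrow> c v = c' v) \<Longrightarrow> P c \<Longrightarrow> P c'"
  shows "subshift_of_finite_type A {c \<in> configs A. \<forall>u. P (shift u c)}"
proof -
  define F where "F = {q \<in> patterns A. dom q = W \<and> (\<exists>c. \<not> P c \<and> (\<forall>v\<in>W. q v = Some (c v)))}"
  have "F \<subseteq> {q. dom q = W \<and> ran q \<subseteq> A}" by (auto simp: F_def patterns_def)
  then have "finite F"
    using finite_set_of_finite_maps[OF assms(2,1)] finite_subset by blast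
  moreover have "\<not> (\<exists>q\<in>F. appears_in q (Some \<circ> c)) \<longleftrightarrow> (\<forall>u. P (shift u c))"
    if c: "c \<in> configs A" for c
  proof safe
    fix u
    assume no: "\<not> (\<exists>q\<in>F. appears_in q (Some \<circ> c))"
    show "P (shift u c)"
    proof (rule ccontr)
      assume "\<not> P (shift u c)"
      moreover define q where "q = (Some \<circ> shift u c) |` W"
      moreover have "ran q \<subseteq> A" "dom q = W"
        using c by (auto simp: q_def ran_def restrict_map_def configs_def shift_def split: if_splits)
      ultimately have "q \<in> F" by (auto simp: F_def patterns_def)
      moreover have "appears_in q (Some \<circ> c)"
        unfolding appears_in_def \<open>dom q = W\<close>
        by (rule exI[of _ u]) (simp add: q_def shift_def)
      ultimately show False using no by blast
    qed
  next
    fix q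
    assume P: "\<forall>u. P (shift u c)" and "q \<in> F" "appears_in q (Some \<circ> c)"
    then obtain u where "\<forall>v\<in>dom q. q v = Some (c (v - u))"
      by (auto simp: appears_in_def)
    moreover obtain c' where "\<not> P c'" "dom q = W" "\<forall>v\<in>W. q v = Some (c' v)"
      using \<open>q \<in> F\<close> unfolding F_def by blast
    ultimately have "shift u c v = c' v" if "v \<in> W" for v
      using that by (simp add: shift_def)
    then have "P c'" using loc[of "shift u c" c'] P by blast
    then show False using \<open>\<not> P c'\<close> by blast
  qed
  then have "{c \<in> configs A. \<forall>u. P (shift u c)} = avoiding A F"
    by (auto simp: avoiding_def)
  ultimately show ?thesis
    unfolding subshift_of_finite_type_def using assms(2)
    by (intro exI[of _ F]) (auto simp: F_def)
qed

section \<open>The complexity of sparse binary configurations\<close>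

lemma card_rect_language_sparse:
  assumes bin: "range c \<subseteq> {0, 1}"
    and one: "c z = (1::nat)"
    and sparse: "\<And>x y x' y'. c (x, y) = 1 \<Longrightarrow> c (x', y') = 1 \<Longrightarrow>
      \<bar>x - x'\<bar> < int m \<Longrightarrow> \<bar>y - y'\<bar> < int n \<Longrightarrow> x = x' \<and> y = y'"
    and gap: "\<And>x y. x \<in> {a..<a + int m} \<Longrightarrow> y \<in> {b..<b + int n} \<Longrightarrow> c (x, y) = 0"
  shows "card (rect_language m n c) = m * n + 1"
proof -
  define B where "B = {0..<int m} \<times> {0..<int n}"
  define pat where "pat Z = (\<lambda>v. if v \<in> B then Some (if v \<in> Z then 1 else 0 :: nat) else None)" for Z
  define I where "I = insert {} ((\<lambda>v. {v}) ` B)"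
  have near: "v = v'" if "v \<in> B" "v' \<in> B" "c (v - u) = 1" "c (v' - u) = 1" for v v' u
  proof (cases v; cases v'; cases u)
    fix x y x' y' s t
    assume v: "v = (x, y)" "v' = (x', y')" "u = (s, t)"
    with that have "c (x - s, y - t) = 1" "c (x' - s, y' - t) = 1" "\<bar>(x - s) - (x' - s)\<bar> < int m"
      "\<bar>(y - t) - (y' - t)\<bar> < int n"
      by (auto simp: B_def)
    with sparse have "x - s = x' - s \<and> y - t = y' - t" by blast
    with v show ?thesis by simp
  qed
  have "rect_language m n c = pat ` I"
  proof (intro equalityI subsetI)
    fix p assume "p \<in> rect_language m n c"
    then obtain u where dom: "dom p = B" and u: "\<And>v. v \<in> B \<Longrightarrow> p v = Some (c (v - u))"
      by (auto simp: rect_language_def appears_in_def B_def)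
    define Z where "Z = {v \<in> B. c (v - u) = 1}"
    have "c (v - u) = 0 \<or> c (v - u) = 1" for v using bin by auto
    then have "p = pat Z"
      using u dom by (force simp: pat_def Z_def)
    moreover have "Z \<in> I"
    proof (cases "Z = {}")
      case False
      then obtain v where "v \<in> Z" by blast
      then have v: "v \<in> B" "c (v - u) = 1" by (auto simp: Z_def)
      then have "v' = v" if "v' \<in> Z" for v' using near[of v' v u] that by (simp add: Z_def)
      with \<open>v \<in> Z\<close> have "Z = {v}" by blast
      then show ?thesis using v by (simp add: I_def)
    qed (simp add: I_def)
    ultimately show "p \<in> pat ` I" by blast
  next
    fix p assume "p \<in> pat ` I"
    then obtain Z where Z: "Z \<in> I" "p = pat Z" by blast
    have dom: "dom p = B" using Z by (auto simp: pat_def split: if_splits)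
    have "\<exists>u. \<forall>v\<in>B. p v = Some (c (v - u))"
    proof (cases "Z = {}")
      case True
      \<comment> \<open>This shift places the window on the empty rectangle at
        \<open>(a, b)\<close>.\<close>
      then have "\<forall>v\<in>B. p v = Some (c (v - (- a, - b)))"
        using gap by (auto simp: Z pat_def B_def)
      then show ?thesis by blast
    next
      case False
      then obtain v where v: "Z = {v}" "v \<in> B" using Z by (auto simp: I_def)
      \<comment> \<open>The shift by \<open>v - z\<close> carries the one at \<open>z\<close> to
        \<open>v\<close>; by \<open>near\<close> no other one enters the window.\<close>
      have "c (v' - (v - z)) = (if v' = v then 1 else 0)" if "v' \<in> B" for v'
      proof (cases "v' = v")
        case False
        then have "c (v' - (v - z)) \<noteq> 1" using near[OF that v(2), of "v - z"] one by auto
        moreover have "c (v' - (v - z)) \<in> {0, 1}" using bin by blast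
        ultimately show ?thesis using False by simp
      qed (simp add: one)
      then have "\<forall>v'\<in>B. p v' = Some (c (v' - (v - z)))"
        using v by (simp add: Z pat_def)
      then show ?thesis by blast
    qed
    then show "p \<in> rect_language m n c"
      using dom by (auto simp: rect_language_def appears_in_def B_def)
  qed
  moreover have "inj_on pat (Pow B)"
    by (intro inj_onI) (auto simp: pat_def fun_eq_iff split: if_splits)
  then have "inj_on pat I" by (rule inj_on_subset) (auto simp: I_def)
  moreover have "card I = m * n + 1"
    by (subst I_def, subst card_insert_disjoint)
      (auto simp: B_def card_image inj_on_def card_cartesian_product)
  ultimately show ?thesis by (simp add: card_image)
qed

section \<open>Encoding tilings by sparse binary configurations\<close>

lemma residue_unique:
  assumes "k * i + r = k * j + s" "0 \<le> r" "r < k" "0 \<le> s" "s < k"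
  shows "i = j \<and> r = (s :: int)"
proof -
  have "(k * i + r) div k = i" "(k * j + s) div k = j" using assms(2-5) by auto
  with assms(1) have "i = j" by simp
  with assms(1) show ?thesis by simp
qed

text \<open>The cell \<open>(i, j)\<close> becomes a square of side \<open>3 D\<close> with two ones: a marker in its corner, and
  one whose horizontal position gives the tile. The rows of the latter are \<open>D\<close> above
  those of the markers and \<open>2 D\<close> below the next ones, so markers can be recognised.\<close>

locale tile_encoding =
  fixes S :: "'t set" and R :: "'t \<Rightarrow> 't \<Rightarrow> 't \<Rightarrow> bool" and code :: "'t \<Rightarrow> int" and D :: int
  assumes code_inj: "inj_on code S"
    and code_range: "t \<in> S \<Longrightarrow> 0 \<le> code t" "t \<in> S \<Longrightarrow> code t < D"
    and D_pos: "0 < D"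
begin

section \<open>The encoding and its change of origin\<close>

definition marked :: "int \<Rightarrow> int \<Rightarrow> (int \<Rightarrow> int \<Rightarrow> 't) \<Rightarrow> int \<Rightarrow> int \<Rightarrow> bool" where
  "marked a b w x y \<longleftrightarrow> (\<exists>i j. (x = a + 3 * D * i \<and> y = b + 3 * D * j) \<or>
     (x = a + 3 * D * i + (D + code (w i j)) \<and> y = b + 3 * D * j + D))"

definition encode :: "int \<Rightarrow> int \<Rightarrow> (int \<Rightarrow> int \<Rightarrow> 't) \<Rightarrow> nat config" where
  "encode a b w = (\<lambda>(x, y). if marked a b w x y then 1 else 0)"

definition encodings :: "nat config set" where
  "encodings = {encode a b w |a b w. w \<in> tilings S R}"

lemma markedE:
  assumes "marked a b w x y"
  obtains i j e f where "x = a + (3 * D * i + e)" "y = b + (3 * D * j + f)"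
    "e = 0 \<and> f = 0 \<or> e = D + code (w i j) \<and> f = D"
proof -
  obtain i j where "(x = a + 3 * D * i \<and> y = b + 3 * D * j) \<or>
     (x = a + 3 * D * i + (D + code (w i j)) \<and> y = b + 3 * D * j + D)"
    using assms unfolding marked_def by blast
  then show thesis using that[of i 0 j 0] that[of i "D + code (w i j)" j D] by auto
qed

lemma encode_eq_1_iff: "encode a b w (x, y) = 1 \<longleftrightarrow> marked a b w x y"
  by (simp add: encode_def)

lemma range_encode: "range (encode a b w) \<subseteq> {0, 1}"
  by (auto simp: encode_def split: if_splits)

lemma encode_eq_iff:
  "encode a b w (x, y) = encode a' b' w' (x, y) \<longleftrightarrow> (marked a b w x y \<longleftrightarrow> marked a' b' w' x y)"
  by (auto simp: encode_def)

lemma marked_translate: "marked a b w (x - s) (y - t) \<longleftrightarrow> marked (a + s) (b + t) w x y"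
proof -
  have "(x - s = a + z \<longleftrightarrow> x = a + s + z) \<and> (y - t = b + z \<longleftrightarrow> y = b + t + z)" for z by auto
  then show ?thesis unfolding marked_def by (simp add: add.assoc)
qed

lemma shift_encode: "shift (s, t) (encode a b w) = encode (a + s) (b + t) w"
  by (auto simp: shift_def encode_def marked_translate)

text \<open>Offsets matter only modulo \<open>3 * D\<close>: whole blocks are absorbed by reindexing
  the tiling.\<close>

lemma marked_origin_shift:
  "marked (a + 3 * D * s) (b + 3 * D * t) w x y \<longleftrightarrow> marked a b (\<lambda>i j. w (i - s) (j - t)) x y"
proof
  assume "marked (a + 3 * D * s) (b + 3 * D * t) w x y"
  then obtain i j where "(x = a + 3 * D * (i + s) \<and> y = b + 3 * D * (j + t)) \<or>
     (x = a + 3 * D * (i + s) + (D + code (w (i + s - s) (j + t - t))) \<and> y = b + 3 * D * (j + t) + D)"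
    unfolding marked_def by (auto simp: algebra_simps)
  then show "marked a b (\<lambda>i j. w (i - s) (j - t)) x y" unfolding marked_def by blast
next
  assume "marked a b (\<lambda>i j. w (i - s) (j - t)) x y"
  then obtain i j where "(x = a + 3 * D * s + 3 * D * (i - s) \<and> y = b + 3 * D * t + 3 * D * (j - t)) \<or>
     (x = a + 3 * D * s + 3 * D * (i - s) + (D + code (w (i - s) (j - t))) \<and>
      y = b + 3 * D * t + 3 * D * (j - t) + D)"
    unfolding marked_def by (auto simp: algebra_simps)
  then show "marked (a + 3 * D * s) (b + 3 * D * t) w x y" unfolding marked_def by blast
qed

lemma encode_origin_shift:
  "encode (a + 3 * D * s) (b + 3 * D * t) w = encode a b (\<lambda>i j. w (i - s) (j - t))"
  by (simp add: encode_def marked_origin_shift)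

lemma tilings_translate: "w \<in> tilings S R \<Longrightarrow> (\<lambda>i j. w (i - s) (j - t)) \<in> tilings S R"
  unfolding tilings_def by (simp add: diff_add_eq[symmetric])

lemma tilings_tile: "w \<in> tilings S R \<Longrightarrow> w i j \<in> S"
  by (simp add: tilings_def)

lemma encode_normalise:
  assumes "w \<in> tilings S R"
  obtains a' b' w' where "encode a b w = encode a' b' w'" "w' \<in> tilings S R"
    "a' \<in> {0..<3 * D}" "b' \<in> {0..<3 * D}"
proof
  show "encode a b w = encode (a mod (3 * D)) (b mod (3 * D))
      (\<lambda>i j. w (i - a div (3 * D)) (j - b div (3 * D)))"
    using encode_origin_shift[of "a mod (3 * D)" "a div (3 * D)" "b mod (3 * D)" "b div (3 * D)" w]
    by simp
qed (use D_pos tilings_translate[OF assms] in auto)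

section \<open>Recovering the phase and the tiles from finite windows\<close>

lemma marked_block_iff:
  assumes w: "\<And>i j. w i j \<in> S" and ef: "e \<in> {0..<3 * D}" "f \<in> {0..<3 * D}"
  shows "marked a b w (a + 3 * D * i + e) (b + 3 * D * j + f) \<longleftrightarrow>
    (e = 0 \<and> f = 0) \<or> (e = D + code (w i j) \<and> f = D)"
proof
  assume "marked a b w (a + 3 * D * i + e) (b + 3 * D * j + f)"
  then obtain i' j' where "(3 * D * i + e = 3 * D * i' + 0 \<and> 3 * D * j + f = 3 * D * j' + 0) \<or>
      (3 * D * i + e = 3 * D * i' + (D + code (w i' j')) \<and> 3 * D * j + f = 3 * D * j' + D)"
    unfolding marked_def by auto
  then show "(e = 0 \<and> f = 0) \<or> (e = D + code (w i j) \<and> f = D)"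
    using residue_unique[of "3 * D" i e i' 0] residue_unique[of "3 * D" j f j' 0]
      residue_unique[of "3 * D" i e i' "D + code (w i' j')"] residue_unique[of "3 * D" j f j' D]
      ef D_pos code_range[OF w[of i' j']] by auto
next
  assume "(e = 0 \<and> f = 0) \<or> (e = D + code (w i j) \<and> f = D)"
  then show "marked a b w (a + 3 * D * i + e) (b + 3 * D * j + f)"
    unfolding marked_def by (intro exI[of _ i] exI[of _ j]) auto
qed

lemma marked_data_iff:
  assumes "\<And>i j. w i j \<in> S" "0 \<le> k" "k < D"
  shows "marked a b w (a + 3 * D * i + (D + k)) (b + 3 * D * j + D) \<longleftrightarrow> code (w i j) = k"
  using assms D_pos by (subst marked_block_iff) auto

text \<open>A square of side \<open>6 * D\<close> contains both ones of some block of the first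
  encoding. Matching them with ones of the second forces marker to fall on marker, and then the
  offsets agree modulo \<open>3 * D\<close>.\<close>

lemma phase_unique:
  assumes w: "\<And>i j. w i j \<in> S" and w': "\<And>i j. w' i j \<in> S"
    and agree: "\<And>x y. x \<in> {s..<s + 6 * D} \<Longrightarrow> y \<in> {t..<t + 6 * D} \<Longrightarrow>
      marked a b w x y \<longleftrightarrow> marked a' b' w' x y"
    and range: "a \<in> {0..<3 * D}" "b \<in> {0..<3 * D}" "a' \<in> {0..<3 * D}" "b' \<in> {0..<3 * D}"
  shows "a = a' \<and> b = b'"
proof -
  \<comment> \<open>These indices select the block whose marker lies in the lower left quarter of
    the square.\<close>
  define i where "i = - ((a - s) div (3 * D))"
  define j where "j = - ((b - t) div (3 * D))"
  have "a + 3 * D * i = s + (a - s) mod (3 * D)" "b + 3 * D * j = t + (b - t) mod (3 * D)"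
    by (simp_all add: i_def j_def minus_mult_div_eq_mod[symmetric])
  then have near: "a + 3 * D * i \<in> {s..<s + 3 * D}" "b + 3 * D * j \<in> {t..<t + 3 * D}"
    using D_pos by auto
  have c: "0 \<le> code (w i j)" "code (w i j) < D" using code_range w by auto
  have "marked a b w (a + 3 * D * i) (b + 3 * D * j)" by (auto simp: marked_def)
  then have "marked a' b' w' (a + 3 * D * i) (b + 3 * D * j)"
    using agree near D_pos by auto
  moreover have "marked a b w (a + 3 * D * i + (D + code (w i j))) (b + 3 * D * j + D)"
    by (auto simp: marked_def)
  then have "marked a' b' w' (a + 3 * D * i + (D + code (w i j))) (b + 3 * D * j + D)"
    using agree near D_pos c by auto
  then obtain j2 where "b + 3 * D * j + D = b' + 3 * D * j2 \<or> b + 3 * D * j + D = b' + 3 * D * j2 + D"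
    unfolding marked_def by blast
  \<comment> \<open>If the marker fell on a data row of the second encoding, the data one,
    \<open>D\<close> higher, would fall on an empty row with residue \<open>2 * D\<close>.\<close>
  then have "b + 3 * D * j \<noteq> b' + 3 * D * j1 + D" for j1
    using residue_unique[of "3 * D" j1 "2 * D" j2 0] residue_unique[of "3 * D" j1 "2 * D" j2 D] D_pos
    by auto
  ultimately obtain i1 j1 where "3 * D * i + a = 3 * D * i1 + a'" "3 * D * j + b = 3 * D * j1 + b'"
    unfolding marked_def by (auto simp: add.commute)
  then show ?thesis
    using residue_unique[of "3 * D" i a i1 a'] residue_unique[of "3 * D" j b j1 b'] range by auto
qed

text \<open>With side \<open>9 * D\<close>, windows one step apart overlap in more than the square
  \<open>phase_unique\<close> asks for, and a window placed at a block corner contains that block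
  with its right and upper neighbours.\<close>

definition window :: "(int \<times> int) set" where
  "window = {0..<9 * D} \<times> {0..<9 * D}"

definition locally_encoding :: "nat config \<Rightarrow> bool" where
  "locally_encoding c \<longleftrightarrow> (\<exists>c'\<in>encodings. \<forall>v\<in>window. c v = c' v)"

lemma encodings_shift: "c \<in> encodings \<Longrightarrow> shift u c \<in> encodings"
  by (cases u) (use shift_encode in \<open>fastforce simp: encodings_def\<close>)

text \<open>Each window brings its own offset and tiling. Overlaps force a common offset; the tile
  of each block is then taken from the window at its corner, and neighbouring windows agree on
  shared blocks, which yields the rule.\<close>

lemma encodings_if_locally_encoding:
  assumes loc: "\<And>u. locally_encoding (shift u c)"
  shows "c \<in> encodings"
proof -
  define near where "near s t v \<longleftrightarrow> v \<in> {s..<s + 9 * D} \<times> {t..<t + 9 * D}" for s t and v :: "int \<times> int"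
  have "\<exists>a b w. w \<in> tilings S R \<and> a \<in> {0..<3 * D} \<and> b \<in> {0..<3 * D} \<and>
      (\<forall>v. near s t v \<longrightarrow> c v = encode a b w v)" for s t
  proof -
    obtain c' where c': "c' \<in> encodings" and eq: "\<And>v. v \<in> window \<Longrightarrow> shift (- s, - t) c v = c' v"
      using loc unfolding locally_encoding_def by blast
    have "shift (s, t) c' \<in> encodings" using c' by (rule encodings_shift)
    then obtain a b w where w: "w \<in> tilings S R" "shift (s, t) c' = encode a b w"
      by (auto simp: encodings_def)
    obtain a' b' w' where w': "encode a b w = encode a' b' w'" "w' \<in> tilings S R"
      "a' \<in> {0..<3 * D}" "b' \<in> {0..<3 * D}"
      using encode_normalise[OF w(1)] .
    have "c v = encode a' b' w' v" if "near s t v" for v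
    proof -
      have "v - (s, t) \<in> window" using that by (cases v) (auto simp: near_def window_def)
      from eq[OF this] have "c v = shift (s, t) c' v" by (cases v) (simp add: shift_def)
      then show ?thesis by (simp add: w w')
    qed
    with w' show ?thesis by blast
  qed
  then obtain a b w where w: "\<And>s t. w s t \<in> tilings S R"
    and range: "\<And>s t. a s t \<in> {0..<3 * D}" "\<And>s t. b s t \<in> {0..<3 * D}"
    and c: "\<And>s t v. near s t v \<Longrightarrow> c v = encode (a s t) (b s t) (w s t) v"
    by metis
  have same: "a s t = a s' t' \<and> b s t = b s' t'"
    if "s' \<in> {s..s + 1}" "t' \<in> {t..t + 1}" for s t s' t'
  proof (rule phase_unique[of "w s t" "w s' t'" s' t'])
    fix x y assume "x \<in> {s'..<s' + 6 * D}" "y \<in> {t'..<t' + 6 * D}"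
    then have "near s t (x, y)" "near s' t' (x, y)" using that D_pos by (auto simp: near_def)
    from c[OF this(1)] c[OF this(2)]
    have "encode (a s t) (b s t) (w s t) (x, y) = encode (a s' t') (b s' t') (w s' t') (x, y)"
      by simp
    then show "marked (a s t) (b s t) (w s t) x y \<longleftrightarrow> marked (a s' t') (b s' t') (w s' t') x y"
      by (simp only: encode_eq_iff)
  qed (simp_all only: range tilings_tile[OF w])
  \<comment> \<open>Unit steps link every window to the one at the origin, first along rows and then
    along column 0.\<close>
  have row: "a s t = a 0 t \<and> b s t = b 0 t" for s t
  proof (induction s rule: int_induct[where k = 0])
    case (step1 i)
    then show ?case using same[where s = i and s' = "i + 1" and t = t and t' = t] by simp
  next
    case (step2 i)
    then show ?case using same[where s = "i - 1" and s' = i and t = t and t' = t] by simp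
  qed simp
  have col: "a 0 t = a 0 0 \<and> b 0 t = b 0 0" for t
  proof (induction t rule: int_induct[where k = 0])
    case (step1 i)
    then show ?case using same[where s = 0 and s' = 0 and t = i and t' = "i + 1"] by simp
  next
    case (step2 i)
    then show ?case using same[where s = 0 and s' = 0 and t = "i - 1" and t' = i] by simp
  qed simp
  define a0 b0 where "a0 = a 0 0" and "b0 = b 0 0"
  have c: "c v = encode a0 b0 (w s t) v" if "near s t v" for s t v
    using c[OF that] row[of s t] col[of t] by (simp add: a0_def b0_def)
  define W where "W i j = w (a0 + 3 * D * i) (b0 + 3 * D * j)" for i j
  have W: "c (a0 + 3 * D * i + x, b0 + 3 * D * j + y) =
      encode a0 b0 (W i j) (a0 + 3 * D * i + x, b0 + 3 * D * j + y)"
    if "x \<in> {0..<9 * D}" "y \<in> {0..<9 * D}" for i j x y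
    using that unfolding W_def by (intro c) (auto simp: near_def)
  have S: "W i j k l \<in> S" for i j k l using tilings_tile[OF w] by (simp add: W_def)
  \<comment> \<open>Both windows see the data one of block \<open>(i', j')\<close>, whose position
    determines the tile since \<open>code\<close> is injective on \<open>S\<close>.\<close>
  have decode: "W i j i' j' = W i' j' i' j'"
    if "i' \<in> {i..i + 1}" "j' \<in> {j..j + 1}" for i j i' j'
  proof -
    define k where "k = code (W i j i' j')"
    have k: "0 \<le> k" "k < D" using code_range S by (auto simp: k_def)
    define x y where "x = a0 + 3 * D * i' + (D + k)" and "y = b0 + 3 * D * j' + D"
    have x: "x = a0 + 3 * D * i + (3 * D * (i' - i) + (D + k))"
      and y: "y = b0 + 3 * D * j + (3 * D * (j' - j) + D)"
      by (simp_all add: x_def y_def algebra_simps)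
    have "i' - i = 0 \<or> i' - i = 1" "j' - j = 0 \<or> j' - j = 1" using that by auto
    then have "3 * D * (i' - i) + (D + k) \<in> {0..<9 * D}" "3 * D * (j' - j) + D \<in> {0..<9 * D}"
      using k D_pos by auto
    from W[OF this, of i j] have "c (x, y) = encode a0 b0 (W i j) (x, y)"
      by (simp only: x y)
    moreover have "c (x, y) = encode a0 b0 (W i' j') (x, y)"
      unfolding x_def y_def using k D_pos by (intro W) auto
    moreover have "marked a0 b0 (W i j) x y"
      unfolding x_def y_def using marked_data_iff[of "W i j" k, OF S k] by (simp add: k_def)
    ultimately have "marked a0 b0 (W i' j') x y"
      using encode_eq_iff by metis
    then have "code (W i' j' i' j') = code (W i j i' j')"
      unfolding x_def y_def using marked_data_iff[of "W i' j'" k, OF S k] by (simp add: k_def)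
    then have "W i' j' i' j' = W i j i' j'" by (rule inj_onD[OF code_inj _ S S])
    then show ?thesis ..
  qed
  \<comment> \<open>The diagonal: each block is read from its own window.\<close>
  define T where "T i j = W i j i j" for i j
  have "T \<in> tilings S R"
  proof -
    have "R (T i j) (T (i + 1) j) (T i (j + 1))" for i j
    proof -
      have "W i j \<in> tilings S R" using w by (simp add: W_def)
      then have "R (W i j i j) (W i j (i + 1) j) (W i j i (j + 1))" by (simp add: tilings_def)
      then show ?thesis using decode[of "i + 1" i j j] decode[of i i "j + 1" j] by (simp add: T_def)
    qed
    moreover have "T i j \<in> S" for i j by (simp add: T_def S)
    ultimately show ?thesis by (simp add: tilings_def)
  qed
  moreover have "c = encode a0 b0 T"
  proof
    fix v :: "int \<times> int"
    obtain x y where v: "v = (x, y)" by (cases v)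
    define i j where "i = (x - a0) div (3 * D)" and "j = (y - b0) div (3 * D)"
    define e f where "e = (x - a0) mod (3 * D)" and "f = (y - b0) mod (3 * D)"
    have ef: "e \<in> {0..<3 * D}" "f \<in> {0..<3 * D}" using D_pos by (auto simp: e_def f_def)
    have xy: "x = a0 + 3 * D * i + e" "y = b0 + 3 * D * j + f"
      by (simp_all add: i_def j_def e_def f_def)
    have "c v = encode a0 b0 (W i j) v"
      unfolding v xy using ef D_pos by (intro W) auto
    moreover have "marked a0 b0 (W i j) x y \<longleftrightarrow> marked a0 b0 T x y"
      unfolding xy using marked_block_iff[of "W i j" e f, OF S ef] marked_block_iff[of T e f, OF _ ef]
      by (simp add: T_def S)
    ultimately show "c v = encode a0 b0 T v" by (simp add: v encode_def)
  qed
  ultimately show ?thesis by (auto simp: encodings_def)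
qed

lemma subshift_encodings: "subshift_of_finite_type {0, 1} encodings"
proof -
  have "encodings = {c \<in> configs {0, 1}. \<forall>u. locally_encoding (shift u c)}"
  proof (intro equalityI subsetI CollectI conjI allI)
    fix c u assume "c \<in> encodings"
    then show "locally_encoding (shift u c)"
      unfolding locally_encoding_def by (intro bexI[of _ "shift u c"] encodings_shift) simp
    obtain a b w where "c = encode a b w" using \<open>c \<in> encodings\<close> unfolding encodings_def by blast
    then show "c \<in> configs {0, 1}" using range_encode by (simp only: configs_def mem_Collect_eq)
  next
    fix c assume "c \<in> {c \<in> configs {0, 1}. \<forall>u. locally_encoding (shift u c)}"
    then show "c \<in> encodings" using encodings_if_locally_encoding by blast
  qed
  moreover have "subshift_of_finite_type {0, 1} {c \<in> configs {0, 1}. \<forall>u. locally_encoding (shift u c)}"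
    by (rule subshift_of_finite_type_local[where W = window])
      (simp_all add: window_def locally_encoding_def)
  ultimately show ?thesis by simp
qed

section \<open>Periods and complexity of encodings\<close>

lemma encode_period:
  assumes w: "w \<in> tilings S R" and per: "shift (s, t) (encode a b w) = encode a b w"
  shows "w (i + s) (j + t) = w i j"
proof -
  \<comment> \<open>A period need not respect the blocks, but its \<open>3 * D\<close>-fold multiple
    does, and that multiple translates the tiling by exactly \<open>(s, t)\<close>.\<close>
  have iter: "shift (int k * s, int k * t) (encode a b w) = encode a b w" for k
  proof (induction k)
    case (Suc k)
    have "shift (int (Suc k) * s, int (Suc k) * t) (encode a b w) =
        shift (s, t) (shift (int k * s, int k * t) (encode a b w))"
      by (simp add: shift_encode algebra_simps)
    also have "\<dots> = encode a b w" by (simp add: Suc per)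
    finally show ?case .
  qed (simp add: shift_encode)
  from iter[of "nat (3 * D)"] have
    "encode a b (\<lambda>i j. w (i - s) (j - t)) = encode a b w"
    using D_pos by (simp add: shift_encode encode_origin_shift)
  then have eq: "marked a b (\<lambda>i j. w (i - s) (j - t)) x y \<longleftrightarrow> marked a b w x y" for x y
    by (auto simp: encode_def fun_eq_iff split: if_splits)
  define k where "k = code (w i j)"
  have k: "0 \<le> k" "k < D" using code_range tilings_tile[OF w] by (auto simp: k_def)
  have "code (w (i + s) (j + t)) = k"
    using eq[of "a + 3 * D * (i + s) + (D + k)" "b + 3 * D * (j + t) + D"]
      marked_data_iff[of "\<lambda>i j. w (i - s) (j - t)" k a b "i + s" "j + t"]
      marked_data_iff[of w k a b "i + s" "j + t"] k tilings_tile[OF w]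
    by (simp add: k_def)
  then show ?thesis using code_inj tilings_tile[OF w] unfolding k_def by (metis inj_onD)
qed

lemma aperiodic_encodings:
  assumes "tilings S R \<noteq> {}"
    and "\<And>w s t. w \<in> tilings S R \<Longrightarrow> (s, t) \<noteq> (0, 0) \<Longrightarrow>
      \<exists>i j. w (i + s) (j + t) \<noteq> w i j"
  shows "aperiodic encodings"
  unfolding aperiodic_def periodic_def
proof (intro conjI ballI notI)
  fix c assume "c \<in> encodings" "\<exists>u. u \<noteq> (0, 0) \<and> shift u c = c"
  then obtain a b w s t where w: "w \<in> tilings S R" and "(s, t) \<noteq> (0, 0)"
    "shift (s, t) (encode a b w) = encode a b w"
    unfolding encodings_def by fast
  then show False using assms(2)[OF w] encode_period[OF w] by blast
qed (use assms(1) in \<open>auto simp: encodings_def\<close>)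

lemma card_rect_language_encoding:
  assumes "c \<in> encodings" "int m \<le> D" "int n \<le> D"
  shows "card (rect_language m n c) = m * n + 1"
proof -
  obtain a b w where w: "w \<in> tilings S R" and c: "c = encode a b w"
    using assms(1) by (auto simp: encodings_def)
  have S: "w i j \<in> S" for i j using tilings_tile[OF w] .
  show ?thesis
  proof (rule card_rect_language_sparse)
    show "range c \<subseteq> {0, 1}" unfolding c by (rule range_encode)
    have "marked a b w a b" unfolding marked_def by (intro exI[of _ 0]) simp
    then show "c (a, b) = 1" by (simp only: c encode_eq_1_iff)
  next
    fix x y x' y'
    assume one: "c (x, y) = 1" "c (x', y') = 1" and near: "\<bar>x - x'\<bar> < int m" "\<bar>y - y'\<bar> < int n"
    from one have "marked a b w x y" "marked a b w x' y'"
      by (simp_all only: c encode_eq_1_iff)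
    from markedE[OF this(1)] obtain i j e f where 1: "x = a + (3 * D * i + e)"
      "y = b + (3 * D * j + f)" "e = 0 \<and> f = 0 \<or> e = D + code (w i j) \<and> f = D" .
    from markedE[OF \<open>marked a b w x' y'\<close>] obtain i' j' e' f' where 2: "x' = a + (3 * D * i' + e')"
      "y' = b + (3 * D * j' + f')" "e' = 0 \<and> f' = 0 \<or> e' = D + code (w i' j') \<and> f' = D" .
    \<comment> \<open>Distinct multiples of \<open>3 * D\<close> are at least \<open>3 * D\<close>
      apart, while the two bounds allow less than \<open>2 * D\<close>.\<close>
    have close: "p = q" if "\<bar>(3 * D * p + r) - (3 * D * q + s)\<bar> < D" "\<bar>r - s\<bar> \<le> D" for p q r s
    proof -
      have "\<bar>3 * D * (p - q)\<bar> < 3 * D * 1" using that D_pos by (simp add: algebra_simps)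
      then have "\<bar>p - q\<bar> < 1" using D_pos by (simp add: abs_mult)
      then show ?thesis by simp
    qed
    have "j = j'"
    proof (rule close)
      show "\<bar>3 * D * j + f - (3 * D * j' + f')\<bar> < D" using 1(2) 2(2) near(2) assms(3) by linarith
      show "\<bar>f - f'\<bar> \<le> D" using 1(3) 2(3) D_pos by auto
    qed
    then have "\<bar>f - f'\<bar> < D" using 1(2) 2(2) near(2) assms(3) by simp
    then have "f = f'" using 1(3) 2(3) D_pos by auto
    then have kind: "e = 0 \<and> e' = 0 \<or> e = D + code (w i j) \<and> e' = D + code (w i' j')"
      using 1(3) 2(3) D_pos by auto
    have "i = i'"
    proof (rule close)
      show "\<bar>3 * D * i + e - (3 * D * i' + e')\<bar> < D" using 1(1) 2(1) near(1) assms(2) by linarith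
      show "\<bar>e - e'\<bar> \<le> D"
        using kind code_range[OF S[of i j]] code_range[OF S[of i' j']] D_pos by auto
    qed
    then show "x = x' \<and> y = y'" using 1 2 kind \<open>j = j'\<close> \<open>f = f'\<close> by auto
  next
    \<comment> \<open>The upper third of each block row carries no ones and has height
      \<open>D\<close>, hence contains the window.\<close>
    fix x y
    assume "y \<in> {b + 2 * D..<b + 2 * D + int n}"
    moreover define r where "r = y - b - 2 * D"
    ultimately have r: "y = b + 2 * D + r" "0 \<le> r" "r < D"
      using assms(3) by auto
    have "\<not> marked a b w x y"
    proof
      assume "marked a b w x y"
      then obtain j f where "3 * D * 0 + (2 * D + r) = 3 * D * j + f" "f = 0 \<or> f = D"
        unfolding r by (elim markedE) auto
      from residue_unique[OF this(1)] this(2) r D_pos show False by auto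
    qed
    then show "c (x, y) = 0" by (simp add: c encode_def)
  qed
qed

end

theorem theorem6:
  fixes m n :: nat
  shows "\<exists>(A :: nat set) (X :: nat config set).
    finite A \<and> subshift_of_finite_type A X \<and> aperiodic X \<and>
    (\<forall>c\<in>X. card (rect_language m n c) = m * n + 1)"
proof -
  have "finite multiplier_tiles" by (simp add: multiplier_tiles_def)
  then obtain k and enum :: "_ \<Rightarrow> nat" where
    enum: "enum ` multiplier_tiles = {i. i < k}" "inj_on enum multiplier_tiles"
    using finite_imp_inj_to_nat_seg by blast
  \<comment> \<open>Large enough for the \<open>k\<close> tile codes and for both sides of the
    window; the summand 1 keeps it positive.\<close>
  define D where "D = int (k + m + n + 1)"
  interpret tile_encoding multiplier_tiles multiplier_rule "int \<circ> enum" D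
  proof
    show "inj_on (int \<circ> enum) multiplier_tiles"
      using enum(2) by (auto simp: inj_on_def)
    fix t assume "t \<in> multiplier_tiles"
    then have "enum t < k" using enum(1) by blast
    then show "0 \<le> (int \<circ> enum) t" "(int \<circ> enum) t < D" by (simp_all add: D_def)
  qed (simp add: D_def)
  have "aperiodic encodings"
    using multiplier_tilings_nonempty multiplier_tiling_no_period
    by (intro aperiodic_encodings) blast+
  moreover have "card (rect_language m n c) = m * n + 1" if "c \<in> encodings" for c
    using that by (rule card_rect_language_encoding) (simp_all add: D_def)
  ultimately show ?thesis
    using subshift_encodings by (intro exI[of _ "{0, 1}"] exI[of _ encodings]) simp
qed

end
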